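(* Let $(X,\delta)$ be a finite symmetric diversity. Then $(X,\delta)$ is Minkowski-embeddable if and only if \[ \frac{\delta(A \setminus \{a\})}{\delta(A)} \geq \frac{|A|-2}{|A|-1} \] for all $A \subseteq X$ with $|A| \geq 2$ and all $a \in A$.
   Context: A convex body in $\mathbb{R}^d$ is a compact, convex set with non-empty interior. For a convex body $K$ in $\mathbb{R}^d$ and bounded $A \subseteq \mathbb{R}^d$, the generalized circumradius of $A$ with respect to $K$ is \[R(A,K) = \inf\{\lambda \ge 0 : A \subseteq \lambda K+x \mbox{ for some } x \in \mathbb{R}^d\}.\] A diversity is a pair $(X,\delta)$ where $X$ is a set and $\delta$ is a function from the finite subsets of $X$ to $\mathbb{R}_{\geq 0}$ such that, for all finite $A,B,C \subseteq X$: (D1) $\delta(A)=0$ if and only if $|A| \leq 1$; (D2) if $B \neq \emptyset$ then $\delta(A \cup C) \leq \delta(A \cup B) + \delta(B \cup C)$. It is finite if $X$ is finite, and symmetric if $\delta(A) = \delta(B)$ whenever $A,B \subseteq X$ are finite with $|A| = |B|$. A diversity $(X,\delta)$ is Minkowski-embeddable if for some $d$ there is a map $\phi:X \rightarrow \mathbb{R}^d$ and a convex body $K$ in $\mathbb{R}^d$ such that $\delta(A) = R(\phi(A),K)$ for all finite $A \subseteq X$. *)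

theory Defs
  imports "HOL-Analysis.Analysis"
begin

text \<open>
  The dimension \<open>d\<close> is existentially quantified in the notion of Minkowski-embeddability, so
  \<open>d\<close>-dimensional space is taken to be the library's \<^const>\<open>Euclidean_space\<close>: real sequences
  vanishing from index \<open>d\<close> on, with the usual topology. As \<^typ>\<open>nat \<Rightarrow> real\<close> is not an instance of
  \<^class>\<open>real_vector\<close>, the vector operations are written pointwise.
\<close>

definition convex_body :: "nat \<Rightarrow> (nat \<Rightarrow> real) set \<Rightarrow> bool" where
  "convex_body d K \<longleftrightarrow>
     compactin (Euclidean_space d) K \<and>
     (\<forall>x\<in>K. \<forall>y\<in>K. \<forall>u\<ge>0. \<forall>v\<ge>0. u + v = 1 \<longrightarrow> (\<lambda>i. u * x i + v * y i) \<in> K) \<and>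
     Euclidean_space d interior_of K \<noteq> {}"

definition circumradius :: "nat \<Rightarrow> (nat \<Rightarrow> real) set \<Rightarrow> (nat \<Rightarrow> real) set \<Rightarrow> real" where
  "circumradius d A K =
     Inf {r. 0 \<le> r \<and>
            (\<exists>x \<in> topspace (Euclidean_space d). A \<subseteq> (\<lambda>k i. r * k i + x i) ` K)}"

locale diversity =
  fixes X :: "'a set" and \<delta> :: "'a set \<Rightarrow> real"
  assumes nonneg: "\<lbrakk>finite A; A \<subseteq> X\<rbrakk> \<Longrightarrow> 0 \<le> \<delta> A"
    and eq_0_iff: "\<lbrakk>finite A; A \<subseteq> X\<rbrakk> \<Longrightarrow> \<delta> A = 0 \<longleftrightarrow> card A \<le> 1"
    and triangle: "\<lbrakk>finite A; finite B; finite C; A \<subseteq> X; B \<subseteq> X; C \<subseteq> X; B \<noteq> {}\<rbrakk>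
      \<Longrightarrow> \<delta> (A \<union> C) \<le> \<delta> (A \<union> B) + \<delta> (B \<union> C)"

definition symmetric_diversity :: "'a set \<Rightarrow> ('a set \<Rightarrow> real) \<Rightarrow> bool" where
  "symmetric_diversity X \<delta> \<longleftrightarrow> diversity X \<delta> \<and>
     (\<forall>A B. finite A \<and> finite B \<and> A \<subseteq> X \<and> B \<subseteq> X \<and> card A = card B \<longrightarrow> \<delta> A = \<delta> B)"

definition Minkowski_embeddable :: "'a set \<Rightarrow> ('a set \<Rightarrow> real) \<Rightarrow> bool" where
  "Minkowski_embeddable X \<delta> \<longleftrightarrow>
     (\<exists>d. \<exists>\<phi> \<in> X \<rightarrow> topspace (Euclidean_space d). \<exists>K. convex_body d K \<and>
        (\<forall>A. finite A \<and> A \<subseteq> X \<longrightarrow> \<delta> A = circumradius d (\<phi> ` A) K))"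

end

theory Submission
  imports Defs
begin

text \<open>
  Write \<open>n = |A|\<close>. If each \<open>A - {a}\<close> lies in \<open>r K + x\<^sub>a\<close>, then averaging the relations
  \<open>q - x\<^sub>a \<in> r K\<close> over the pairs \<open>q \<noteq> a\<close> that contain \<open>p\<close>, with weight \<open>n - 1\<close> on the pairs where \<open>q = p\<close> and weight
  \<open>1\<close> on those where \<open>a = p\<close>, places every \<open>p \<in> A\<close> in one common translate of
  \<open>((n - 1) / (n - 2)) r K\<close>.

  Conversely, let \<open>f k\<close> be the value of the diversity on sets of size \<open>k\<close>. Send \<open>X\<close> to the standard
  basis of \<open>\<real>\<^sup>n\<close>, with \<open>n = |X|\<close>, and let \<open>K\<close> be cut out by the inequalities
  \<open>\<Sum>a\<in>A. y p - y a \<le> (|A| - 1) / f |A|\<close> for \<open>p \<in> A\<close>, intersected with a large box. Every translate of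
  \<open>r K\<close> containing the points of \<open>A\<close> has \<open>r \<ge> f |A|\<close>, by summing these inequalities over \<open>p \<in> A\<close>, and
  the translate of \<open>f |A| K\<close> centred at the indicator vector of \<open>A\<close> does contain them exactly because
  \<open>f k\<close> increases and \<open>f k / (k - 1)\<close> decreases.
\<close>

section \<open>Circumradius as an infimum of admissible dilation factors\<close>

text \<open>The predicate behind the infimum in \<open>circumradius\<close>, with the image spelled
  out pointwise so that a point of \<open>K\<close> can be chosen for each \<open>p\<close>.\<close>

definition covers :: "nat \<Rightarrow> (nat \<Rightarrow> real) set \<Rightarrow> (nat \<Rightarrow> real) set \<Rightarrow> real \<Rightarrow> bool" where
  "covers d K A r \<longleftrightarrow> 0 \<le> r \<and>
     (\<exists>x \<in> topspace (Euclidean_space d). \<forall>p\<in>A. \<exists>k\<in>K. p = (\<lambda>i. r * k i + x i))"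

lemma coversI:
  assumes "0 \<le> r" "x \<in> topspace (Euclidean_space d)"
    and "\<And>p. p \<in> A \<Longrightarrow> \<exists>k\<in>K. p = (\<lambda>i. r * k i + x i)"
  shows "covers d K A r"
  unfolding covers_def using assms by blast

lemma circumradius_covers: "circumradius d A K = Inf {r. covers d K A r}"
  unfolding circumradius_def covers_def by (rule arg_cong[where f = Inf]) (auto simp: image_iff subset_iff)

lemma circumradius_le: "covers d K A r \<Longrightarrow> circumradius d A K \<le> r"
  unfolding circumradius_covers by (rule cInf_lower) (auto simp: covers_def intro!: bdd_belowI[of _ 0])

lemma circumradius_eqI:
  assumes "covers d K A r" "\<And>s. covers d K A s \<Longrightarrow> r \<le> s"
  shows "circumradius d A K = r"
  unfolding circumradius_covers by (rule cInf_eq_minimum) (use assms in auto)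

section \<open>Convex bodies and coverings by their translates\<close>

lemma topspace_Euclidean_space_iff: "x \<in> topspace (Euclidean_space d) \<longleftrightarrow> (\<forall>i\<ge>d. x i = 0)"
  by (simp add: topspace_Euclidean_space)

lemma openin_Euclidean_space_iff:
  "openin (Euclidean_space d) U \<longleftrightarrow> (\<exists>V. open V \<and> U = V \<inter> topspace (Euclidean_space d))"
  unfolding Euclidean_space_def
  by (simp add: openin_subtopology euclidean_product_topology)

lemma convex_body_combination:
  assumes "convex_body d K" "x \<in> K" "y \<in> K" "u \<ge> 0" "v \<ge> 0" "u + v = 1"
  shows "(\<lambda>i. u * x i + v * y i) \<in> K"
  using assms unfolding convex_body_def by blast

lemma convex_body_subset: "convex_body d K \<Longrightarrow> K \<subseteq> topspace (Euclidean_space d)"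
  unfolding convex_body_def by (meson compactin_subset_topspace)

text \<open>Induction: the mean over \<open>insert x F\<close> is the two-point combination of
  \<open>k x\<close>, with weight \<open>1 / (?m + 1)\<close>, and the mean over
  \<open>F\<close>.\<close>

lemma convex_body_mean:
  assumes K: "convex_body d K"
    and "finite I" "I \<noteq> {}" "\<And>j. j \<in> I \<Longrightarrow> k j \<in> K"
  shows "(\<lambda>i. (\<Sum>j\<in>I. k j i) / real (card I)) \<in> K"
  using assms(2-)
proof (induction rule: finite_ne_induct)
  case (singleton x)
  then show ?case by simp
next
  case (insert x F)
  let ?m = "real (card F)"
  have m: "?m > 0" using insert by (simp add: card_gt_0_iff)
  have "(\<lambda>i. 1 / (?m + 1) * k x i + ?m / (?m + 1) * ((\<Sum>j\<in>F. k j i) / ?m)) \<in> K"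
    by (rule convex_body_combination[OF K]) (use insert m in \<open>auto simp: field_simps\<close>)
  also have "(\<lambda>i. 1 / (?m + 1) * k x i + ?m / (?m + 1) * ((\<Sum>j\<in>F. k j i) / ?m))
      = (\<lambda>i. (\<Sum>j\<in>insert x F. k j i) / real (card (insert x F)))"
    using insert m by (auto simp: add_divide_distrib add.commute)
  finally show ?case .
qed

text \<open>By convexity \<open>s K\<close> contains \<open>r K + (s - r) k0\<close> for any
  \<open>k0\<close> in \<open>K\<close>. As \<open>K\<close> may miss the origin, the centre moves
  by \<open>(s - r) k0\<close>.\<close>

lemma covers_mono:
  assumes K: "convex_body d K" and c: "covers d K A r" and "r \<le> s"
  shows "covers d K A s"
\<comment> \<open>Otherwise a point of \<open>A\<close> supplies \<open>k0\<close>, and division by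
  \<open>s\<close> is possible.\<close>
proof (cases "A = {} \<or> s = 0")
  case True
  have "(\<lambda>_. 0) \<in> topspace (Euclidean_space d)" by (simp add: topspace_Euclidean_space_iff)
  with True show ?thesis
    using c \<open>r \<le> s\<close> by (cases "r = s") (auto simp: covers_def)
next
  case False
  obtain x where r: "0 \<le> r" and x: "x \<in> topspace (Euclidean_space d)"
    and k: "\<And>p. p \<in> A \<Longrightarrow> \<exists>k\<in>K. p = (\<lambda>i. r * k i + x i)"
    using c unfolding covers_def by blast
  obtain k0 where k0: "k0 \<in> K" using False k by blast
  have s: "s > 0" using False r \<open>r \<le> s\<close> by linarith
  define y where "y = (\<lambda>i. x i - (s - r) * k0 i)"
  have "y \<in> topspace (Euclidean_space d)"
    using x k0 convex_body_subset[OF K] by (auto simp: topspace_Euclidean_space_iff y_def subset_iff)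
  moreover have "\<exists>k\<in>K. p = (\<lambda>i. s * k i + y i)" if "p \<in> A" for p
  proof -
    obtain k where "k \<in> K" and p: "p = (\<lambda>i. r * k i + x i)" using k \<open>p \<in> A\<close> by blast
    have "(\<lambda>i. r / s * k i + (1 - r / s) * k0 i) \<in> K"
      by (rule convex_body_combination[OF K]) (use \<open>k \<in> K\<close> k0 r s \<open>r \<le> s\<close> in auto)
    moreover have "p = (\<lambda>i. s * (r / s * k i + (1 - r / s) * k0 i) + y i)"
      using s by (auto simp: p y_def field_simps)
    ultimately show ?thesis by (intro bexI[of _ "\<lambda>i. r / s * k i + (1 - r / s) * k0 i"])
  qed
  ultimately show ?thesis using s unfolding covers_def by auto
qed

text \<open>Around an interior point \<open>z\<close>, all \<open>z + t p\<close> lie in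
  \<open>K\<close> for small \<open>t > 0\<close>; solving for \<open>p\<close> gives the factor
  \<open>1 / t\<close> and the centre \<open>- z / t\<close>. Thus the infimum in
  \<open>circumradius\<close> is over a nonempty set.\<close>

lemma convex_body_covers_finite:
  assumes K: "convex_body d K" and "finite A" and A: "A \<subseteq> topspace (Euclidean_space d)"
  shows "\<exists>r. covers d K A r"
proof -
  obtain z where z: "z \<in> Euclidean_space d interior_of K" using K unfolding convex_body_def by blast
  obtain V where "open V" and V: "Euclidean_space d interior_of K = V \<inter> topspace (Euclidean_space d)"
    using openin_interior_of openin_Euclidean_space_iff by metis
  have zt: "z \<in> topspace (Euclidean_space d)" using z V by blast
  have "\<forall>\<^sub>F t in at_right (0::real). (\<lambda>i. z i + t * p i) \<in> K" if "p \<in> A" for p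
  proof -
    have "continuous_on UNIV (\<lambda>t::real. (\<lambda>i. z i + t * p i))"
      by (intro continuous_on_coordinatewise_then_product continuous_intros)
    then have "((\<lambda>t::real. (\<lambda>i. z i + t * p i)) \<longlongrightarrow> (\<lambda>i. z i + 0 * p i)) (at 0)"
      unfolding continuous_on_def by blast
    then have "((\<lambda>t::real. (\<lambda>i. z i + t * p i)) \<longlongrightarrow> (\<lambda>i. z i + 0 * p i)) (at_right 0)"
      by (rule tendsto_mono[OF at_le[OF subset_UNIV]])
    then have "\<forall>\<^sub>F t in at_right (0::real). (\<lambda>i. z i + t * p i) \<in> V"
      using \<open>open V\<close> z V by (intro topological_tendstoD) auto
    then show ?thesis
    proof eventually_elim
      case (elim t)
      have "(\<lambda>i. z i + t * p i) \<in> topspace (Euclidean_space d)"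
        using zt A \<open>p \<in> A\<close> by (auto simp: topspace_Euclidean_space_iff subset_iff)
      with elim have "(\<lambda>i. z i + t * p i) \<in> Euclidean_space d interior_of K" unfolding V by simp
      then show ?case by (rule subsetD[OF interior_of_subset])
    qed
  qed
  then have "\<forall>\<^sub>F t in at_right (0::real). \<forall>p\<in>A. (\<lambda>i. z i + t * p i) \<in> K"
    using \<open>finite A\<close> by (simp add: eventually_ball_finite)
  moreover have "\<forall>\<^sub>F t in at_right (0::real). t > 0" by (simp add: eventually_at_right_less)
  ultimately have "\<forall>\<^sub>F t in at_right (0::real). t > 0 \<and> (\<forall>p\<in>A. (\<lambda>i. z i + t * p i) \<in> K)"
    by eventually_elim auto
  from eventually_happens'[OF trivial_limit_at_right_real this]
  obtain t :: real where t: "t > 0" and tK: "\<And>p. p \<in> A \<Longrightarrow> (\<lambda>i. z i + t * p i) \<in> K" by blast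
  have "covers d K A (1 / t)"
  proof (rule coversI[where x = "\<lambda>i. - z i / t"])
    fix p assume "p \<in> A"
    show "\<exists>k\<in>K. p = (\<lambda>i. 1 / t * k i + - z i / t)"
      by (rule bexI[OF _ tK[OF \<open>p \<in> A\<close>]]) (use t in \<open>auto simp: field_simps\<close>)
  qed (use t zt in \<open>auto simp: topspace_Euclidean_space_iff\<close>)
  then show ?thesis by blast
qed

text \<open>Some admissible factor lies below \<open>r\<close>, and \<open>covers_mono\<close>
  raises it. Factors strictly above the infimum suffice later, where \<open>dense_ge\<close> passes
  to the limit.\<close>

lemma covers_above_circumradius:
  assumes "convex_body d K" "finite A" "A \<subseteq> topspace (Euclidean_space d)" "circumradius d A K < r"
  shows "covers d K A r"
proof -
  have "{r. covers d K A r} \<noteq> {}" using convex_body_covers_finite assms by simp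
  from cInf_lessD[OF this, of r] assms(4) obtain s where "covers d K A s" "s < r"
    by (auto simp: circumradius_covers)
  then show ?thesis using covers_mono assms(1) by simp
qed

section \<open>Necessity: the averaging argument\<close>

lemma covers_from_deletions:
  fixes \<phi> :: "'a \<Rightarrow> nat \<Rightarrow> real"
  assumes K: "convex_body d K" and "finite A" and "card A \<ge> 3"
    and \<phi>: "\<phi> ` A \<subseteq> topspace (Euclidean_space d)"
    and c: "\<And>b. b \<in> A \<Longrightarrow> covers d K (\<phi> ` (A - {b})) r"
  shows "covers d K (\<phi> ` A) ((real (card A) - 1) / (real (card A) - 2) * r)"
proof -
  define n where "n = real (card A)"
  have n: "n \<ge> 3" using \<open>card A \<ge> 3\<close> by (simp add: n_def)
  have "\<forall>b\<in>A. \<exists>x\<in>topspace (Euclidean_space d). \<forall>p\<in>A - {b}. \<exists>k\<in>K. \<phi> p = (\<lambda>i. r * k i + x i)"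
    using c unfolding covers_def by simp
  then obtain x where x: "\<And>b. b \<in> A \<Longrightarrow> x b \<in> topspace (Euclidean_space d)"
    and "\<forall>b\<in>A. \<forall>p\<in>A - {b}. \<exists>k\<in>K. \<phi> p = (\<lambda>i. r * k i + x b i)"
    by metis
  then obtain k where kK: "\<And>b p. b \<in> A \<Longrightarrow> p \<in> A - {b} \<Longrightarrow> k b p \<in> K"
    and k: "\<And>b p. b \<in> A \<Longrightarrow> p \<in> A - {b} \<Longrightarrow> \<phi> p = (\<lambda>i. r * k b p i + x b i)"
    by metis
  obtain b where "b \<in> A" using \<open>card A \<ge> 3\<close> by fastforce
  then have r: "r \<ge> 0" using c unfolding covers_def by blast
  \<comment> \<open>The average below amounts to \<open>(n - 2) * (\<phi> p i - y i)\<close>, which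
    forces this centre; it does not depend on \<open>p\<close>.\<close>
  define y where "y = (\<lambda>i. ((n - 1) * (\<Sum>a\<in>A. x a i) - (\<Sum>a\<in>A. \<phi> a i)) / (n * (n - 2)))"
  have "y \<in> topspace (Euclidean_space d)"
    using x \<phi> by (simp add: topspace_Euclidean_space_iff y_def image_subset_iff)
  moreover have "\<exists>\<kappa>\<in>K. \<phi> p = (\<lambda>i. (n - 1) / (n - 2) * r * \<kappa> i + y i)" if p: "p \<in> A" for p
  proof -
    have card: "real (card (A - {p})) = n - 1"
      using p \<open>finite A\<close> n by (simp add: n_def of_nat_diff Suc_le_eq card_gt_0_iff)
    \<comment> \<open>The weights \<open>(n - 1) / n\<close> and \<open>1 / n\<close> balance the
      \<open>n - 1\<close> copies of \<open>x p\<close> coming from the points \<open>k p a\<close>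
      against the single \<open>x p\<close> missing from the sum of the \<open>x a\<close>.\<close>
    let ?\<kappa> = "\<lambda>i. (\<Sum>a\<in>A - {p}. (n - 1) / n * k a p i + 1 / n * k p a i) / real (card (A - {p}))"
    have "A - {p} \<noteq> {}" using card n by (intro notI) simp
    then have "?\<kappa> \<in> K"
      using kK p n \<open>finite A\<close>
      by (intro convex_body_mean[OF K] convex_body_combination[OF K]) (auto simp: field_simps)
    moreover have "\<phi> p i = (n - 1) / (n - 2) * r * ?\<kappa> i + y i" for i
    proof -
      define S where "S = (\<Sum>a\<in>A. x a i)"
      define T where "T = (\<Sum>a\<in>A. \<phi> a i)"
      have 1: "(\<Sum>a\<in>A - {p}. r * k a p i) = (n - 1) * \<phi> p i - (S - x p i)"
      proof -
        have "r * k a p i = \<phi> p i - x a i" if "a \<in> A - {p}" for a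
          using k[of a p] that p by (auto dest: fun_cong)
        then have "(\<Sum>a\<in>A - {p}. r * k a p i) = (\<Sum>a\<in>A - {p}. \<phi> p i - x a i)" by simp
        also have "\<dots> = (n - 1) * \<phi> p i - (S - x p i)"
          using card p \<open>finite A\<close> by (simp add: sum_subtractf sum_diff1 S_def)
        finally show ?thesis .
      qed
      have 2: "(\<Sum>a\<in>A - {p}. r * k p a i) = (T - \<phi> p i) - (n - 1) * x p i"
      proof -
        have "r * k p a i = \<phi> a i - x p i" if "a \<in> A - {p}" for a
          using k[of p a] that p by (auto dest: fun_cong)
        then have "(\<Sum>a\<in>A - {p}. r * k p a i) = (\<Sum>a\<in>A - {p}. \<phi> a i - x p i)" by simp
        also have "\<dots> = (T - \<phi> p i) - (n - 1) * x p i"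
          using card p \<open>finite A\<close> by (simp add: sum_subtractf sum_diff1 T_def)
        finally show ?thesis .
      qed
      have "(n - 1) * r * ?\<kappa> i
          = r * (\<Sum>a\<in>A - {p}. (n - 1) / n * k a p i + 1 / n * k p a i)"
        using n by (simp add: card)
      also have "\<dots> = (n - 1) / n * (\<Sum>a\<in>A - {p}. r * k a p i) + 1 / n * (\<Sum>a\<in>A - {p}. r * k p a i)"
        by (simp only: sum.distrib sum_distrib_left distrib_left mult.left_commute[of r])
      also have "\<dots> = ((n - 1) * ((n - 1) * \<phi> p i - S) + (T - \<phi> p i)) / n"
        unfolding 1 2 using n by (simp add: field_simps)
      \<comment> \<open>The coefficient of \<open>\<phi> p i\<close> is
        \<open>((n - 1)^2 - 1) / n = n - 2\<close>.\<close>
      also have "\<dots> = (n - 2) * (\<phi> p i - y i)"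
        using n unfolding y_def S_def[symmetric] T_def[symmetric] by (simp add: field_simps)
      finally have "(n - 1) * r * ?\<kappa> i = (n - 2) * (\<phi> p i - y i)" .
      moreover have "\<phi> p i = (n - 1) / (n - 2) * r * z + y i"
        if "(n - 1) * r * z = (n - 2) * (\<phi> p i - y i)" for z
        using n that by (simp add: field_simps)
      ultimately show ?thesis by blast
    qed
    ultimately show ?thesis by (intro bexI[of _ ?\<kappa>] ext)
  qed
  ultimately show ?thesis
    using n r unfolding covers_def n_def by auto
qed

lemma Minkowski_embeddable_imp_deletion_bound:
  assumes sym: "symmetric_diversity X \<delta>" and emb: "Minkowski_embeddable X \<delta>"
    and A: "A \<subseteq> X" "2 \<le> card A" and a: "a \<in> A"
  shows "\<delta> (A - {a}) / \<delta> A \<ge> (real (card A) - 2) / (real (card A) - 1)"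
proof -
  interpret diversity X \<delta> using sym unfolding symmetric_diversity_def by blast
  have fin: "finite A" using A(2) card.infinite by fastforce
  have "\<delta> A \<noteq> 0" using eq_0_iff[OF fin A(1)] A(2) by simp
  then have pos: "\<delta> A > 0" using nonneg[OF fin A(1)] by simp
  have nn: "\<delta> (A - {a}) \<ge> 0" using fin A by (intro nonneg) auto
  show ?thesis
  \<comment> \<open>For two points the claimed bound is 0, while
    \<open>covers_from_deletions\<close> asks for three points.\<close>
  proof (cases "card A = 2")
    case True
    with pos nn show ?thesis by simp
  next
    case False
    define n where "n = real (card A)"
    have c3: "card A \<ge> 3" using False A by simp
    then have n: "n \<ge> 3" by (simp add: n_def)
    obtain d \<phi> K where \<phi>: "\<phi> \<in> X \<rightarrow> topspace (Euclidean_space d)" and K: "convex_body d K"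
      and \<delta>: "\<And>A. finite A \<Longrightarrow> A \<subseteq> X \<Longrightarrow> \<delta> A = circumradius d (\<phi> ` A) K"
      using emb[unfolded Minkowski_embeddable_def] by (elim exE bexE conjE) (rule that, assumption+, simp)
    have \<phi>A: "\<phi> ` A \<subseteq> topspace (Euclidean_space d)" using \<phi> A(1) by auto
    have "\<delta> A / ((n - 1) / (n - 2)) \<le> r" if r: "r > \<delta> (A - {a})" for r
    proof -
      have "covers d K (\<phi> ` (A - {b})) r" if b: "b \<in> A" for b
      proof (rule covers_above_circumradius[OF K])
        \<comment> \<open>Symmetry gives all deletions the same value, so one \<open>r\<close>
          serves every \<open>b\<close>.\<close>
        have "\<delta> (A - {b}) = \<delta> (A - {a})"
          by (rule sym[unfolded symmetric_diversity_def, THEN conjunct2, rule_format])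
            (use fin A a b in auto)
        moreover have "\<delta> (A - {b}) = circumradius d (\<phi> ` (A - {b})) K" using fin A by (intro \<delta>) auto
        ultimately show "circumradius d (\<phi> ` (A - {b})) K < r" using r by simp
      qed (use fin \<phi>A in auto)
      from circumradius_le[OF covers_from_deletions[OF K fin c3 \<phi>A this]]
      have "\<delta> A \<le> (n - 1) / (n - 2) * r" using \<delta>[OF fin A(1)] by (simp add: n_def)
      then show ?thesis using n by (simp add: field_simps)
    qed
    then have "\<delta> A / ((n - 1) / (n - 2)) \<le> \<delta> (A - {a})" by (rule dense_ge)
    then show ?thesis using n pos unfolding n_def[symmetric] by (simp add: field_simps)
  qed
qed

section \<open>Sufficiency: a convex body realising a given size profile\<close>

text \<open>Beyond \<open>n\<close> only positivity is required; it makes the bounding box nondegenerate for \<open>n \<le> 1\<close>.\<close>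
locale size_profile =
  fixes n :: nat and f :: "nat \<Rightarrow> real"
  assumes pos: "2 \<le> k \<Longrightarrow> 0 < f k"
    and mono: "\<lbrakk>2 \<le> k; k \<le> m; m \<le> n\<rbrakk> \<Longrightarrow> f k \<le> f m"
    and ratio: "\<lbrakk>2 \<le> k; k \<le> m; m \<le> n\<rbrakk> \<Longrightarrow> (real k - 1) * f m \<le> (real m - 1) * f k"
begin

text \<open>The sum constraints are unchanged when a constant is added to all coordinates below
  \<open>n\<close>, so the box is what bounds the set. Its half-width \<open>1 / f 2\<close> still
  admits the vectors of \<open>indicator_shift_in_body\<close>, since
  \<open>f 2 \<le> f (card B)\<close>.\<close>

definition body :: "(nat \<Rightarrow> real) set" where
  "body = {y. (\<forall>i. \<bar>y i\<bar> \<le> (if i < n then 1 / f 2 else 0)) \<and>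
     (\<forall>A p. A \<subseteq> {..<n} \<and> 2 \<le> card A \<and> p \<in> A \<longrightarrow>
        (\<Sum>a\<in>A. y p - y a) \<le> (real (card A) - 1) / f (card A))}"

lemma card_le: "A \<subseteq> {..<n} \<Longrightarrow> card A \<le> n"
  using card_mono[OF finite_lessThan, of A n] by simp

lemma body_subset: "body \<subseteq> topspace (Euclidean_space n)"
proof
  fix y assume "y \<in> body"
  then have "\<bar>y i\<bar> \<le> (if i < n then 1 / f 2 else 0)" for i by (simp add: body_def)
  from this[of i for i] show "y \<in> topspace (Euclidean_space n)"
    unfolding topspace_Euclidean_space_iff by (metis abs_le_zero_iff linorder_not_less)
qed

text \<open>The box is a product of compact intervals, degenerate from index \<open>n\<close> on,
  hence compact by Tychonoff; the sum constraints are closed.\<close>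

lemma compactin_body: "compactin (Euclidean_space n) body"
proof -
  define b where "b i = (if i < n then 1 / f 2 else 0)" for i
  have "compactin (product_topology (\<lambda>_. euclideanreal) UNIV) (PiE UNIV (\<lambda>i. {- b i..b i}))"
    by (subst compactin_PiE) auto
  then have "compact (PiE UNIV (\<lambda>i. {- b i..b i}))"
    by (simp add: euclidean_product_topology)
  moreover have "closed {y. \<forall>A p. A \<subseteq> {..<n} \<and> 2 \<le> card A \<and> p \<in> A \<longrightarrow>
        (\<Sum>a\<in>A. y p - y a) \<le> (real (card A) - 1) / f (card A)}"
    by (intro closed_Collect_all closed_Collect_imp closed_Collect_le open_Collect_const
        continuous_intros continuous_on_product_coordinates)
  moreover have "y \<in> PiE UNIV (\<lambda>i. {- b i..b i}) \<longleftrightarrow> (\<forall>i. \<bar>y i\<bar> \<le> b i)" for y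
    by (auto simp: PiE_iff abs_le_iff minus_le_iff)
  then have "body = PiE UNIV (\<lambda>i. {- b i..b i}) \<inter> {y. \<forall>A p. A \<subseteq> {..<n} \<and> 2 \<le> card A \<and> p \<in> A \<longrightarrow>
        (\<Sum>a\<in>A. y p - y a) \<le> (real (card A) - 1) / f (card A)}"
    unfolding body_def b_def[symmetric] by blast
  ultimately have "compact body" by (simp add: compact_Int_closed)
  then show ?thesis
    using body_subset unfolding Euclidean_space_def
    by (simp add: compactin_subtopology euclidean_product_topology)
qed

lemma convex_body_body: "convex_body n body"
  unfolding convex_body_def
proof (intro conjI ballI allI impI)
  show "compactin (Euclidean_space n) body" by (rule compactin_body)
next
  fix x y and u v :: real
  assume x: "x \<in> body" and y: "y \<in> body" and u: "0 \<le> u" and v: "0 \<le> v" and uv: "u + v = 1"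
  show "(\<lambda>i. u * x i + v * y i) \<in> body"
    unfolding body_def
  proof (intro CollectI conjI allI impI)
    fix i
    let ?c = "if i < n then 1 / f 2 else 0"
    have "\<bar>u * x i + v * y i\<bar> \<le> u * \<bar>x i\<bar> + v * \<bar>y i\<bar>"
      using u v by (metis abs_mult abs_of_nonneg abs_triangle_ineq)
    also have "\<dots> \<le> ?c"
      by (rule convex_bound_le) (use x y u v uv in \<open>simp_all add: body_def\<close>)
    finally show "\<bar>u * x i + v * y i\<bar> \<le> ?c" .
  next
    fix A p
    assume A: "A \<subseteq> {..<n} \<and> 2 \<le> card A \<and> p \<in> A"
    have "(\<Sum>a\<in>A. u * x p + v * y p - (u * x a + v * y a))
        = u * (\<Sum>a\<in>A. x p - x a) + v * (\<Sum>a\<in>A. y p - y a)"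
      by (simp add: sum_distrib_left sum.distrib[symmetric] algebra_simps)
    also have "\<dots> \<le> (real (card A) - 1) / f (card A)"
      by (rule convex_bound_le) (use x y u v uv A in \<open>simp_all add: body_def\<close>)
    finally show "(\<Sum>a\<in>A. u * x p + v * y p - (u * x a + v * y a)) \<le> (real (card A) - 1) / f (card A)" .
  qed
next
  \<comment> \<open>Strict versions of the constraints. Only finitely many are imposed, so
    \<open>V\<close> is open in the product topology; the origin satisfies them because all
    right-hand sides are positive.\<close>
  define V where "V = (\<Inter>i\<in>{..<n}. {y :: nat \<Rightarrow> real. \<bar>y i\<bar> < 1 / f 2}) \<inter>
     (\<Inter>A\<in>{A. A \<subseteq> {..<n} \<and> 2 \<le> card A}. \<Inter>p\<in>A.
        {y. (\<Sum>a\<in>A. y p - y a) < (real (card A) - 1) / f (card A)})"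
  have "finite {A. A \<subseteq> {..<n} \<and> 2 \<le> card A}" by (rule finite_subset[of _ "Pow {..<n}"]) auto
  then have "open V"
    unfolding V_def
    by (intro open_Int open_INT ballI open_Collect_less continuous_intros
        continuous_on_product_coordinates) (auto intro: finite_subset)
  moreover have "V \<inter> topspace (Euclidean_space n) \<subseteq> body"
    by (auto simp: V_def body_def topspace_Euclidean_space_iff intro: less_imp_le)
  ultimately have "V \<inter> topspace (Euclidean_space n) \<subseteq> Euclidean_space n interior_of body"
    by (intro interior_of_maximal) (auto simp: openin_Euclidean_space_iff)
  moreover have "(\<lambda>_. 0) \<in> V \<inter> topspace (Euclidean_space n)"
    by (auto simp: V_def pos topspace_Euclidean_space_iff)
  ultimately show "Euclidean_space n interior_of body \<noteq> {}" by blast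
qed

text \<open>These are the points of \<open>body\<close> that the translate of
  \<open>f (card B)\<close> times \<open>body\<close> centred at \<open>indicator B\<close> must use
  to cover the basis vectors of \<open>B\<close>.\<close>

lemma indicator_shift_in_body:
  assumes B: "B \<subseteq> {..<n}" and k: "2 \<le> card B" and q: "q \<in> B"
  shows "(\<lambda>i. (indicator {q} i - indicator B i) / f (card B)) \<in> body"
proof -
  have fk: "f (card B) > 0" using k by (rule pos)
  have finB: "finite B" by (rule finite_subset[OF B finite_lessThan])
  have "\<bar>(indicator {q} i - indicator B i) / f (card B)\<bar> \<le> (if i < n then 1 / f 2 else 0)" for i
  proof (cases "i \<in> B")
    case True
    have "f 2 \<le> f (card B)" using k B by (intro mono card_le) auto
    with True fk B pos[of 2] q show ?thesis
      by (auto simp: indicator_def field_simps abs_if)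
  qed (use q pos[of 2] in \<open>auto simp: indicator_def\<close>)
  moreover have "(\<Sum>a\<in>A. (indicator {q} p - indicator B p) / f (card B) - (indicator {q} a - indicator B a) / f (card B))
      \<le> (real (card A) - 1) / f (card A)"
    if A: "A \<subseteq> {..<n}" "2 \<le> card A" "p \<in> A" for A p
  proof -
    define k m where "k = card B" and "m = card A"
    have finA: "finite A" by (rule finite_subset[OF A(1) finite_lessThan])
    have fm: "f m > 0" using A unfolding m_def by (intro pos)
    have "(\<Sum>a\<in>A. (indicator {q} p - indicator B p :: real) - (indicator {q} a - indicator B a))
        = real m * (indicator {q} p - indicator B p) - indicator A q + real (card (A \<inter> B))"
    proof -
      have "(\<Sum>a\<in>A. indicator B a) = real (card (A \<inter> B))"
        using finA by (simp add: indicator_def sum.If_cases)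
      moreover have "(\<Sum>a\<in>A. indicator {q} a) = (indicator A q :: real)"
        using finA by (simp add: indicator_def)
      ultimately show ?thesis by (simp add: sum_subtractf m_def)
    qed
    \<comment> \<open>For \<open>p = q\<close> the value is \<open>card (A \<inter> B) - 1\<close>.
      For other \<open>p\<close> in \<open>B\<close> the term \<open>- m\<close> makes it
      nonpositive. For \<open>p\<close> outside \<open>B\<close> the intersection misses
      \<open>p\<close>, and either it misses \<open>q\<close> too or the indicator of
      \<open>A\<close> subtracts 1.\<close>
    also have "\<dots> \<le> real (min k m) - 1"
    proof -
      have "card (A \<inter> B) \<le> k" "card (A \<inter> B) \<le> m"
        using finA finB by (auto simp: k_def m_def intro: card_mono)
      moreover have "card (A \<inter> B) < m" if "p \<notin> B"
        unfolding m_def using that A finA by (intro psubset_card_mono) auto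
      moreover have "card (A \<inter> B) < k" if "q \<notin> A"
        unfolding k_def using that q finB by (intro psubset_card_mono) auto
      moreover have "k \<ge> 2" "m \<ge> 2" using k A by (auto simp: k_def m_def)
      ultimately show ?thesis using q A(3)
        by (cases "p = q"; cases "p \<in> B"; cases "q \<in> A") (auto simp: indicator_def min_def)
    qed
    \<comment> \<open>Larger sets \<open>A\<close> are handled by \<open>ratio\<close>, smaller ones
      by \<open>mono\<close>.\<close>
    also have "\<dots> \<le> (real m - 1) * f k / f m"
    proof (cases "k \<le> m")
      case True
      have "(real k - 1) * f m \<le> (real m - 1) * f k"
        using True k A unfolding k_def m_def by (intro ratio card_le)
      with True fm show ?thesis by (simp add: min_def field_simps)
    next
      case False
      have "f m \<le> f k" using False A B unfolding k_def m_def by (intro mono card_le) auto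
      then have "(real m - 1) * f m \<le> (real m - 1) * f k"
        using A by (intro mult_left_mono) (auto simp: m_def)
      with False fm show ?thesis by (simp add: min_def field_simps)
    qed
    finally have "(\<Sum>a\<in>A. (indicator {q} p - indicator B p) - (indicator {q} a - indicator B a)) / f k
        \<le> ((real m - 1) * f k / f m) / f k"
      using fk by (intro divide_right_mono) (auto simp: k_def)
    then show ?thesis
      using fk by (simp add: sum_divide_distrib diff_divide_distrib k_def m_def)
  qed
  ultimately show ?thesis unfolding body_def by blast
qed

lemma circumradius_body:
  assumes B: "B \<subseteq> {..<n}" and k: "2 \<le> card B"
  shows "circumradius n ((\<lambda>p. indicator {p}) ` B) body = f (card B)"
proof (rule circumradius_eqI)
  have fk: "f (card B) > 0" using k by (rule pos)
  show "covers n body ((\<lambda>p. indicator {p}) ` B) (f (card B))"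
  proof (rule coversI[where x = "indicator B"])
    fix e :: "nat \<Rightarrow> real" assume "e \<in> (\<lambda>p. indicator {p}) ` B"
    then obtain q where q: "q \<in> B" and e: "e = indicator {q}" by blast
    show "\<exists>k\<in>body. e = (\<lambda>i. f (card B) * k i + indicator B i)"
      by (rule bexI[OF _ indicator_shift_in_body[OF B k q]]) (use fk in \<open>auto simp: e\<close>)
  qed (use fk B in \<open>auto simp: topspace_Euclidean_space_iff indicator_def\<close>)
  fix r assume "covers n body ((\<lambda>p. indicator {p}) ` B) r"
  then obtain x where r: "0 \<le> r"
    and "\<forall>q\<in>B. \<exists>k\<in>body. indicator {q} = (\<lambda>i. r * k i + x i)"
    unfolding covers_def by blast
  then obtain y where y: "\<And>q. q \<in> B \<Longrightarrow> y q \<in> body"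
    and e: "\<And>q. q \<in> B \<Longrightarrow> indicator {q} = (\<lambda>i. r * y q i + x i)"
    by metis
  have finB: "finite B" by (rule finite_subset[OF B finite_lessThan])
  \<comment> \<open>The constraint of \<open>body\<close> for the set \<open>B\<close> itself, at
    the point \<open>y p\<close>, scaled by \<open>r\<close>.\<close>
  have "(real (card B) - 1) - (real (card B) * x p - (\<Sum>a\<in>B. x a))
      \<le> r * ((real (card B) - 1) / f (card B))" if p: "p \<in> B" for p
  proof -
    have "r * y p i = indicator {p} i - x i" for i using fun_cong[OF e[OF p], of i] by simp
    then have "r * (\<Sum>a\<in>B. y p p - y p a) = (\<Sum>a\<in>B. (1 - x p) - (indicator {p} a - x a))"
      by (simp add: sum_distrib_left right_diff_distrib)
    also have "\<dots> = (real (card B) - 1) - (real (card B) * x p - (\<Sum>a\<in>B. x a))"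
    proof -
      have "(\<Sum>a\<in>B. indicator {p} a) = (1 :: real)"
        using finB p by (simp add: indicator_def)
      then show ?thesis by (simp add: sum_subtractf right_diff_distrib)
    qed
    finally have "\<dots> = r * (\<Sum>a\<in>B. y p p - y p a)" by simp
    also have "\<dots> \<le> r * ((real (card B) - 1) / f (card B))"
      using y[OF p] B k p r unfolding body_def by (intro mult_left_mono) auto
    finally show ?thesis .
  qed
  \<comment> \<open>Summed over \<open>p\<close>, the terms in \<open>x\<close> cancel, so the bound
    on \<open>r\<close> is independent of the centre.\<close>
  then have "(\<Sum>p\<in>B. (real (card B) - 1) - (real (card B) * x p - (\<Sum>a\<in>B. x a)))
      \<le> (\<Sum>p\<in>B. r * ((real (card B) - 1) / f (card B)))" by (rule sum_mono)
  then have "real (card B) * (real (card B) - 1) \<le> real (card B) * (r * ((real (card B) - 1) / f (card B)))"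
    by (simp add: sum_subtractf sum_distrib_left[symmetric])
  then have "real (card B) * (real (card B) - 1) * 1 \<le> real (card B) * (real (card B) - 1) * (r / f (card B))"
    by (simp add: mult_ac)
  moreover have "0 < real (card B) * (real (card B) - 1)" using k by simp
  ultimately have "1 \<le> r / f (card B)" by (metis mult_le_cancel_left_pos)
  then show "f (card B) \<le> r" using fk by simp
qed

lemma circumradius_body_trivial:
  assumes "B \<subseteq> {..<n}" "card B \<le> 1"
  shows "circumradius n ((\<lambda>p. indicator {p}) ` B) body = 0"
proof (rule circumradius_eqI)
  have "finite B" by (rule finite_subset[OF assms(1) finite_lessThan])
  then obtain q where q: "B \<subseteq> {q}" using assms(2)
    by (metis card_le_Suc0_iff_eq One_nat_def singletonI subsetI empty_iff ex_in_conv)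
  then have "B = {} \<or> B = {q}" by blast
  obtain y where "y \<in> body"
    using convex_body_body interior_of_subset[of "Euclidean_space n" body]
    unfolding convex_body_def by blast
  then show "covers n body ((\<lambda>p. indicator {p}) ` B) 0"
    using \<open>B = {} \<or> B = {q}\<close> assms(1)
    \<comment> \<open>If \<open>B\<close> is empty, \<open>q\<close> is arbitrary and may be at
      least \<open>n\<close>; the guard keeps the centre in the space.\<close>
    by (intro coversI[where x = "\<lambda>i. if q < n then indicator {q} i else 0"])
      (auto simp: topspace_Euclidean_space_iff indicator_def fun_eq_iff)
qed (simp add: covers_def)

end

section \<open>Sufficiency: the size profile of a symmetric diversity\<close>

lemma deletion_bound_imp_Minkowski_embeddable:
  assumes "finite X" and sym: "symmetric_diversity X \<delta>"
    and bound: "\<And>A a. A \<subseteq> X \<Longrightarrow> 2 \<le> card A \<Longrightarrow> a \<in> A \<Longrightarrow>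
      \<delta> (A - {a}) / \<delta> A \<ge> (real (card A) - 2) / (real (card A) - 1)"
  shows "Minkowski_embeddable X \<delta>"
proof -
  interpret diversity X \<delta> using sym unfolding symmetric_diversity_def by blast
  define n where "n = card X"
  \<comment> \<open>By symmetry the chosen representative does not matter. The default 1 supplies
    the positivity that \<open>size_profile\<close> asks for beyond \<open>n\<close>.\<close>
  define f where "f k = (if k \<le> n then \<delta> (SOME A. A \<subseteq> X \<and> card A = k) else 1)" for k
  have fin: "finite A" if "A \<subseteq> X" for A using that \<open>finite X\<close> finite_subset by blast
  have f: "f (card A) = \<delta> A" if A: "A \<subseteq> X" for A
  proof -
    define A' where "A' = (SOME A'. A' \<subseteq> X \<and> card A' = card A)"
    have "A' \<subseteq> X \<and> card A' = card A" unfolding A'_def by (rule someI[of _ A]) (use A in simp)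
    then have "\<delta> A' = \<delta> A" using sym A fin unfolding symmetric_diversity_def by meson
    then show ?thesis using A \<open>finite X\<close> unfolding f_def A'_def n_def by (simp add: card_mono)
  qed
  have subset: "\<exists>A a. A \<subseteq> X \<and> card A = Suc k \<and> a \<in> A \<and> card (A - {a}) = k" if k: "Suc k \<le> n" for k
  proof -
    obtain A where A: "A \<subseteq> X" "card A = Suc k" using k unfolding n_def by (meson obtain_subset_with_card_n)
    then obtain a where "a \<in> A" by fastforce
    then show ?thesis using A fin by (metis card_Diff_singleton diff_Suc_1)
  qed
  have pos: "0 < f k" if "2 \<le> k" for k
  proof (cases "k \<le> n")
    case True
    then obtain A where A: "A \<subseteq> X" "card A = k" unfolding n_def by (meson obtain_subset_with_card_n)
    then have "\<delta> A \<noteq> 0" using eq_0_iff[of A] fin that by simp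
    then show ?thesis using nonneg[of A] A fin f[of A] by simp
  qed (simp add: f_def)
  have mono: "f k \<le> f m" if "k \<le> m" "m \<le> n" for k m
    using that
  proof (induction m rule: dec_induct)
    case (step j)
    obtain A a where A: "A \<subseteq> X" "card A = Suc j" "a \<in> A" "card (A - {a}) = j"
      using subset step.prems by blast
    \<comment> \<open>(D2) with middle set \<open>{a}\<close> and third set empty; the last term
      vanishes by (D1).\<close>
    have "\<delta> ((A - {a}) \<union> {}) \<le> \<delta> ((A - {a}) \<union> {a}) + \<delta> ({a} \<union> {})"
      using A fin by (intro triangle) auto
    moreover have "\<delta> {a} = 0" using A by (subst eq_0_iff) auto
    moreover have "(A - {a}) \<union> {a} = A" using A by blast
    ultimately have "\<delta> (A - {a}) \<le> \<delta> A" by simp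
    moreover have "f j = \<delta> (A - {a})" "f (Suc j) = \<delta> A"
      using f[of "A - {a}"] f[of A] A by auto
    ultimately show ?case using step by simp
  qed simp
  have ratio: "(real k - 1) * f m \<le> (real m - 1) * f k" if "2 \<le> k" "k \<le> m" "m \<le> n" for k m
    using that(2,3)
  proof (induction m rule: dec_induct)
    case (step j)
    obtain A a where A: "A \<subseteq> X" "card A = Suc j" "a \<in> A" "card (A - {a}) = j"
      using subset step.prems by blast
    have j: "j \<ge> 2" using step that by simp
    have "f j = \<delta> (A - {a})" "f (Suc j) = \<delta> A"
      using f[of "A - {a}"] f[of A] A by auto
    with bound[OF A(1) _ A(3)] A(2) j
    \<comment> \<open>The deletion bound for a set of size \<open>j + 1\<close>: one step of the
      decrease of \<open>f k / (k - 1)\<close>, chained below with the induction hypothesis.\<close>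
    have "(real j - 1) / real j \<le> f j / f (Suc j)" by simp
    then have "(real j - 1) * f (Suc j) \<le> real j * f j"
      using j pos[of "Suc j"] by (simp add: field_simps)
    then have "(real k - 1) * ((real j - 1) * f (Suc j)) \<le> (real k - 1) * (real j * f j)"
      using that(1) by (intro mult_left_mono) auto
    also have "\<dots> = real j * ((real k - 1) * f j)" by (simp add: algebra_simps)
    also have "\<dots> \<le> real j * ((real j - 1) * f k)"
      using step by (intro mult_left_mono) auto
    finally have "(real j - 1) * ((real k - 1) * f (Suc j)) \<le> (real j - 1) * (real j * f k)"
      by (simp add: algebra_simps)
    \<comment> \<open>The common factor \<open>real j - 1\<close> is positive because
      \<open>j \<ge> 2\<close>.\<close>
    then show ?case using j by simp
  qed simp
  interpret P: size_profile n f by (rule size_profile.intro; (rule pos | rule mono | rule ratio); assumption)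
  obtain h where h: "bij_betw h X {..<n}"
    using \<open>finite X\<close> unfolding n_def by (metis bij_betw_def ex_bij_betw_finite_nat lessThan_atLeast0)
  have "\<delta> A = circumradius n ((\<lambda>a. indicator {h a}) ` A) P.body" if A: "A \<subseteq> X" for A
  proof -
    have hA: "h ` A \<subseteq> {..<n}" "card (h ` A) = card A"
      using A h by (auto simp: bij_betw_def intro: card_image inj_on_subset)
    have "circumradius n ((\<lambda>p. indicator {p}) ` h ` A) P.body = \<delta> A"
    proof (cases "2 \<le> card A")
      case True
      then show ?thesis using P.circumradius_body[OF hA(1)] hA(2) f[OF A] by simp
    next
      case False
      then show ?thesis
        using P.circumradius_body_trivial[OF hA(1)] hA(2) eq_0_iff[OF fin[OF A] A] by simp
    qed
    then show ?thesis by (simp add: image_image)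
  qed
  moreover have "(\<lambda>a. indicator {h a}) \<in> X \<rightarrow> topspace (Euclidean_space n)"
    using h by (auto simp: topspace_Euclidean_space_iff indicator_def dest!: bij_betwE)
  ultimately show ?thesis
    unfolding Minkowski_embeddable_def using P.convex_body_body by blast
qed

theorem theorem14:
  fixes X :: "'a set" and \<delta> :: "'a set \<Rightarrow> real"
  assumes "finite X" and "symmetric_diversity X \<delta>"
  shows "Minkowski_embeddable X \<delta> \<longleftrightarrow>
    (\<forall>A. A \<subseteq> X \<and> 2 \<le> card A \<longrightarrow>
      (\<forall>a\<in>A. \<delta> (A - {a}) / \<delta> A \<ge> (real (card A) - 2) / (real (card A) - 1)))"
  (is "_ \<longleftrightarrow> ?bound")
proof
  assume "Minkowski_embeddable X \<delta>"
  from Minkowski_embeddable_imp_deletion_bound[OF assms(2) this] show ?bound by simp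
next
  assume ?bound
  then show "Minkowski_embeddable X \<delta>"
    by (intro deletion_bound_imp_Minkowski_embeddable[OF assms]) simp
qed

end
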